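(* Let $n\ge 1$, let $H$ be a nonzero $2^n\times 2^n$ complex matrix, let $P_R,P_L$ be state-preparation oracles for $H$ and $U_{\mathrm{FOX}}=(P_L^\dagger\otimes I_n)\cdot \mathrm{SELECT}\cdot (P_R\otimes I_n)$ (as defined in the context). Suppose that $P_R=V_R\cdot A_R$ and $P_L=V_L\cdot A_L$ with unitaries on $2n$ qubits satisfying $$V_R|0\rangle_{2n}=|0\rangle_{2n},\qquad V_L|0\rangle_{2n}=|0\rangle_{2n},$$ where $A_R$ and $A_L$ consist of only $O(1)$ single-qubit gates. Then, when the $2n$ ancilla qubits are prepared in $|0\rangle_{2n}$, the controlled application of $U_{\mathrm{FOX}}$ can be realized by controlling only $A_R$ and $A_L^\dagger$: for every control-qubit state $|c\rangle=\alpha|0\rangle+\beta|1\rangle$ and every $n$-qubit state $|\varphi\rangle$, $$\Lambda(U_{\mathrm{FOX}})\,|c\rangle|0\rangle_{2n}|\varphi\rangle=\Lambda(A_L^\dagger\otimes I_n)\,\Big(I_1\otimes\big[(V_L^\dagger\otimes I_n)\,\mathrm{SELECT}\,(V_R\otimes I_n)\big]\Big)\,\Lambda(A_R\otimes I_n)\,|c\rangle|0\rangle_{2n}|\varphi\rangle .$$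
   Context: $I_m$ is the identity on $m$ qubits and $|0\rangle_m$ the all-zero state of $m$ qubits. For a unitary $V$, $\Lambda(V)=|0\rangle\langle 0|\otimes I+|1\rangle\langle 1|\otimes V$ is the controlled-$V$ gate with one (first) control qubit. For $i\in\{0,\dots,2^n-1\}$ with bits $\mathtt i_0,\dots,\mathtt i_{n-1}$, $|i\rangle=|\mathtt i_0\rangle\otimes\cdots\otimes|\mathtt i_{n-1}\rangle$. $X,Z$ are the Pauli matrices. Every $2^n\times 2^n$ matrix $H$ is written as $H=\sum_{i,j=0}^{2^n-1}\alpha_{ij}\bigotimes_{\ell=0}^{n-1}Z^{\mathtt j_\ell}X^{\mathtt i_\ell}$ with $\alpha_{ij}\in\mathbb C$. Put $\mathcal N=\sum_{i,j}|\alpha_{ij}|$. State-preparation oracles for $H$ are unitaries $P_R,P_L$ on $2n$ qubits with $$P_R|0\rangle_{2n}=\tfrac1{\sqrt{\mathcal N}}\sum_{i,j}e^{\mathrm i\arg\alpha_{ij}}\sqrt{|\alpha_{ij}|}\,|i\rangle|j\rangle,\qquad P_L|0\rangle_{2n}=\tfrac1{\sqrt{\mathcal N}}\sum_{i,j}\sqrt{|\alpha_{ij}|}\,|i\rangle|j\rangle .$$ $\mathrm{SELECT}$ acts on three $n$-qubit registers: first $n$ CNOT gates (the $\ell$-th qubit of the first register controls an $X$ on the $\ell$-th qubit of the third), then $n$ CZ gates (between the $\ell$-th qubits of the second and third registers); i.e. $\mathrm{SELECT}\,|i\rangle|j\rangle|\varphi\rangle=|i\rangle|j\rangle\otimes\big(\bigotimes_{\ell}Z^{\mathtt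 j_\ell}X^{\mathtt i_\ell}\big)|\varphi\rangle$. "$O(1)$ single-qubit gates" means a number of single-qubit gates bounded by a constant independent of $n$. *)

theory Defs
  imports Complex_Main "Jordan_Normal_Form.Schur_Decomposition"
begin

definition kron :: "complex mat \<Rightarrow> complex mat \<Rightarrow> complex mat" (infixr "\<otimes>\<^sub>m" 73) where
  "A \<otimes>\<^sub>m B = mat (dim_row A * dim_row B) (dim_col A * dim_col B)
     (\<lambda>(r, c). A $$ (r div dim_row B, c div dim_col B) * B $$ (r mod dim_row B, c mod dim_col B))"

definition kron_vec :: "complex vec \<Rightarrow> complex vec \<Rightarrow> complex vec" (infixr "\<otimes>\<^sub>v" 73) where
  "u \<otimes>\<^sub>v v = vec (dim_vec u * dim_vec v) (\<lambda>k. u $ (k div dim_vec v) * v $ (k mod dim_vec v))"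

definition kron_list :: "complex mat list \<Rightarrow> complex mat" where
  "kron_list Ms = foldr (\<otimes>\<^sub>m) Ms (1\<^sub>m 1)"

definition kron_vec_list :: "complex vec list \<Rightarrow> complex vec" where
  "kron_vec_list vs = foldr (\<otimes>\<^sub>v) vs (unit_vec 1 0)"

text \<open>Bits are numbered from the most significant one, so that the tensor product of the
  bits of \<open>i < 2 ^ n\<close> is the \<open>i\<close>-th standard basis vector.\<close>

definition bit_of :: "nat \<Rightarrow> nat \<Rightarrow> nat \<Rightarrow> nat" where
  "bit_of n i l = (i div 2 ^ (n - 1 - l)) mod 2"

definition ket :: "nat \<Rightarrow> nat \<Rightarrow> complex vec" where
  "ket n i = kron_vec_list (map (\<lambda>l. unit_vec 2 (bit_of n i l)) [0..<n])"

definition qstate :: "nat \<Rightarrow> complex vec \<Rightarrow> bool" where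
  "qstate n v \<longleftrightarrow> v \<in> carrier_vec (2 ^ n) \<and> v \<bullet>c v = 1"

text \<open>\<open>unitary_mat d U\<close>: unitary of dimension \<open>d\<close> (not of \<open>d\<close> qubits).\<close>

definition unitary_mat :: "nat \<Rightarrow> complex mat \<Rightarrow> bool" where
  "unitary_mat d U \<longleftrightarrow> U \<in> carrier_mat d d \<and> mat_adjoint U * U = 1\<^sub>m d \<and> U * mat_adjoint U = 1\<^sub>m d"

definition pauli_X :: "complex mat" where
  "pauli_X = mat_of_rows_list 2 [[0, 1], [1, 0]]"

definition pauli_Z :: "complex mat" where
  "pauli_Z = mat_of_rows_list 2 [[1, 0], [0, -1]]"

definition proj0 :: "complex mat" where
  "proj0 = mat_of_rows_list 2 [[1, 0], [0, 0]]"

definition proj1 :: "complex mat" where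
  "proj1 = mat_of_rows_list 2 [[0, 0], [0, 1]]"

definition ctrl :: "complex mat \<Rightarrow> complex mat" ("\<Lambda>") where
  "\<Lambda> V = proj0 \<otimes>\<^sub>m 1\<^sub>m (dim_row V) + proj1 \<otimes>\<^sub>m V"

text \<open>\<open>on_qubit m q G\<close> applies the one-qubit operator \<open>G\<close> to qubit \<open>q < m\<close> of \<open>m\<close> qubits;
  \<open>ctrl_gate m c t G\<close> applies it to qubit \<open>t\<close>, controlled by qubit \<open>c\<close>.\<close>

definition on_qubit :: "nat \<Rightarrow> nat \<Rightarrow> complex mat \<Rightarrow> complex mat" where
  "on_qubit m q G = 1\<^sub>m (2 ^ q) \<otimes>\<^sub>m G \<otimes>\<^sub>m 1\<^sub>m (2 ^ (m - 1 - q))"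

definition ctrl_gate :: "nat \<Rightarrow> nat \<Rightarrow> nat \<Rightarrow> complex mat \<Rightarrow> complex mat" where
  "ctrl_gate m c t G = on_qubit m c proj0 + on_qubit m c proj1 * on_qubit m t G"

text \<open>The head of the list is the gate that is applied first.\<close>

definition circuit :: "nat \<Rightarrow> complex mat list \<Rightarrow> complex mat" where
  "circuit m Gs = fold (\<lambda>G A. G * A) Gs (1\<^sub>m (2 ^ m))"

definition single_qubit_circuit :: "nat \<Rightarrow> nat \<Rightarrow> complex mat \<Rightarrow> bool" where
  "single_qubit_circuit m K A \<longleftrightarrow>
     (\<exists>gs. length gs = K \<and> (\<forall>(q, G) \<in> set gs. q < m \<and> unitary_mat 2 G) \<and>
           A = circuit m (map (\<lambda>(q, G). on_qubit m q G) gs))"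

text \<open>The bound on the number of gates is a property of a family of circuits, one on
  \<open>2 * n\<close> qubits for each \<open>n \<ge> 1\<close>.\<close>

definition O1_single_qubit_gates :: "(nat \<Rightarrow> complex mat) \<Rightarrow> bool" where
  "O1_single_qubit_gates A \<longleftrightarrow> (\<exists>C. \<forall>n\<ge>1. \<exists>K\<le>C. single_qubit_circuit (2 * n) K (A n))"

text \<open>The coefficients \<open>\<alpha> i j\<close> with \<open>i, j < 2 ^ n\<close> are determined by the matrix
  \<open>pauli_expansion n \<alpha>\<close>, since the Pauli strings form a basis; hence the oracles below, stated in
  terms of \<open>\<alpha>\<close>, are oracles for that matrix.\<close>

definition pauli_string :: "nat \<Rightarrow> nat \<Rightarrow> nat \<Rightarrow> complex mat" where
  "pauli_string n i j =
     kron_list (map (\<lambda>l. pauli_Z ^\<^sub>m bit_of n j l * pauli_X ^\<^sub>m bit_of n i l) [0..<n])"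

definition pauli_expansion :: "nat \<Rightarrow> (nat \<Rightarrow> nat \<Rightarrow> complex) \<Rightarrow> complex mat" where
  "pauli_expansion n \<alpha> =
     mat (2 ^ n) (2 ^ n) (\<lambda>rc. \<Sum>i<2 ^ n. \<Sum>j<2 ^ n. \<alpha> i j * pauli_string n i j $$ rc)"

definition pauli_norm :: "nat \<Rightarrow> (nat \<Rightarrow> nat \<Rightarrow> complex) \<Rightarrow> real" where
  "pauli_norm n \<alpha> = (\<Sum>i<2 ^ n. \<Sum>j<2 ^ n. cmod (\<alpha> i j))"

definition double_ket_sum :: "nat \<Rightarrow> (nat \<Rightarrow> nat \<Rightarrow> complex) \<Rightarrow> complex vec" where
  "double_ket_sum n w =
     vec (2 ^ (2 * n)) (\<lambda>k. \<Sum>i<2 ^ n. \<Sum>j<2 ^ n. w i j * (ket n i \<otimes>\<^sub>v ket n j) $ k)"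

definition right_prep_oracle :: "nat \<Rightarrow> (nat \<Rightarrow> nat \<Rightarrow> complex) \<Rightarrow> complex mat \<Rightarrow> bool" where
  "right_prep_oracle n \<alpha> P \<longleftrightarrow> unitary_mat (2 ^ (2 * n)) P \<and>
     P *\<^sub>v ket (2 * n) 0 = complex_of_real (1 / sqrt (pauli_norm n \<alpha>)) \<cdot>\<^sub>v
       double_ket_sum n (\<lambda>i j. exp (\<i> * Arg (\<alpha> i j)) * sqrt (cmod (\<alpha> i j)))"

definition left_prep_oracle :: "nat \<Rightarrow> (nat \<Rightarrow> nat \<Rightarrow> complex) \<Rightarrow> complex mat \<Rightarrow> bool" where
  "left_prep_oracle n \<alpha> P \<longleftrightarrow> unitary_mat (2 ^ (2 * n)) P \<and>
     P *\<^sub>v ket (2 * n) 0 = complex_of_real (1 / sqrt (pauli_norm n \<alpha>)) \<cdot>\<^sub>v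
       double_ket_sum n (\<lambda>i j. sqrt (cmod (\<alpha> i j)))"

text \<open>The three registers are the qubits \<open>0..<n\<close>, \<open>n..<2 * n\<close> and \<open>2 * n..<3 * n\<close>.\<close>

definition SELECT :: "nat \<Rightarrow> complex mat" where
  "SELECT n = circuit (3 * n)
     (map (\<lambda>l. ctrl_gate (3 * n) l (2 * n + l) pauli_X) [0..<n] @
      map (\<lambda>l. ctrl_gate (3 * n) (n + l) (2 * n + l) pauli_Z) [0..<n])"

definition U_FOX :: "nat \<Rightarrow> complex mat \<Rightarrow> complex mat \<Rightarrow> complex mat" where
  "U_FOX n P\<^sub>R P\<^sub>L =
     (mat_adjoint P\<^sub>L \<otimes>\<^sub>m 1\<^sub>m (2 ^ n)) * SELECT n * (P\<^sub>R \<otimes>\<^sub>m 1\<^sub>m (2 ^ n))"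

end

theory Submission
  imports Defs
begin

text \<open>On the control value \<open>0\<close> the right-hand circuit applies \<open>V\<^sub>R\<close>, \<open>SELECT\<close> and \<open>V\<^sub>L\<^sup>\<dagger>\<close>
  to \<open>|0\<rangle>|\<phi>\<rangle>\<close>. Each of them fixes this state: \<open>V\<^sub>R\<close> and \<open>V\<^sub>L\<close> fix \<open>|0\<rangle>\<close>, and all the controls
  of \<open>SELECT\<close> lie in the two ancilla registers. On the control value \<open>1\<close> both circuits apply
  \<open>U_FOX\<close>, since \<open>P\<^sub>L\<^sup>\<dagger> = A\<^sub>L\<^sup>\<dagger> V\<^sub>L\<^sup>\<dagger>\<close> and \<open>P\<^sub>R = V\<^sub>R A\<^sub>R\<close>.\<close>

section \<open>Kronecker products\<close>

lemma div_mod_bounds: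
  assumes "(r::nat) < a * b"
  shows "r div b < a" "r mod b < b"
  using assms by (cases "b = 0"; simp add: less_mult_imp_div_less)+

text \<open>Division with remainder by \<open>b\<close> is a bijection from the indices below
  \<open>a * b\<close> onto the \<open>a\<close> by \<open>b\<close> rectangle, with inverse
  \<open>i * b + j\<close>. Row and column indices of Kronecker products are encoded in this
  way.\<close>

lemma sum_div_mod:
  fixes f :: "nat \<Rightarrow> nat \<Rightarrow> 'a::comm_monoid_add"
  shows "(\<Sum>k<a * b. f (k div b) (k mod b)) = (\<Sum>i<a. \<Sum>j<b. f i j)"
proof -
  have "i * b + j < a * b" if "i < a" "j < b" for i j
  proof -
    have "i * b + j < Suc i * b" using that by simp
    also have "\<dots> \<le> a * b" using that by (intro mult_le_mono1) simp
    finally show ?thesis .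
  qed
  then have "(\<Sum>k<a * b. f (k div b) (k mod b)) = (\<Sum>(i, j)\<in>{..<a} \<times> {..<b}. f i j)"
    by (intro sum.reindex_bij_witness
          [where i = "\<lambda>(i, j). i * b + j" and j = "\<lambda>k. (k div b, k mod b)"])
      (auto simp: div_mod_bounds)
  then show ?thesis by (simp add: sum.cartesian_product)
qed

text \<open>Serves the contraction over the shared index of two Kronecker products: that sum
  separates into one sum for each tensor factor.\<close>

lemma sum_div_mod_prod:
  fixes f g :: "nat \<Rightarrow> complex"
  shows "(\<Sum>k<a * b. f (k div b) * g (k mod b)) = (\<Sum>i<a. f i) * (\<Sum>j<b. g j)"
  by (simp add: sum_div_mod[of "\<lambda>i j. f i * g j"] sum_product)

section \<open>Algebra of Kronecker products of matrices and vectors\<close>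

lemma dim_kron [simp]:
  "dim_row (A \<otimes>\<^sub>m B) = dim_row A * dim_row B" "dim_col (A \<otimes>\<^sub>m B) = dim_col A * dim_col B"
  by (simp_all add: kron_def)

lemma dim_kron_vec [simp]: "dim_vec (u \<otimes>\<^sub>v v) = dim_vec u * dim_vec v"
  by (simp add: kron_vec_def)

lemma kron_carrier [intro]:
  assumes "A \<in> carrier_mat r c" "B \<in> carrier_mat r' c'"
  shows "A \<otimes>\<^sub>m B \<in> carrier_mat (r * r') (c * c')"
  using assms by auto

lemma kron_vec_carrier [intro]:
  assumes "u \<in> carrier_vec r" "v \<in> carrier_vec s"
  shows "u \<otimes>\<^sub>v v \<in> carrier_vec (r * s)"
  using assms by (intro carrier_vecI) simp

lemma index_kron [simp]:
  assumes "r < dim_row A * dim_row B" "c < dim_col A * dim_col B"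
  shows "(A \<otimes>\<^sub>m B) $$ (r, c)
    = A $$ (r div dim_row B, c div dim_col B) * B $$ (r mod dim_row B, c mod dim_col B)"
  using assms by (simp add: kron_def)

lemma index_kron_vec [simp]:
  assumes "k < dim_vec u * dim_vec v"
  shows "(u \<otimes>\<^sub>v v) $ k = u $ (k div dim_vec v) * v $ (k mod dim_vec v)"
  using assms by (simp add: kron_vec_def)

lemma kron_mult_vec:
  assumes "dim_col A = dim_vec u" "dim_col B = dim_vec v"
  shows "(A \<otimes>\<^sub>m B) *\<^sub>v (u \<otimes>\<^sub>v v) = (A *\<^sub>v u) \<otimes>\<^sub>v (B *\<^sub>v v)" (is "?l = ?r")
proof (rule eq_vecI)
  fix r assume "r < dim_vec ?r"
  then have r: "r < dim_row A * dim_row B" by simp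
  note b = div_mod_bounds[OF r]
  have "?l $ r = (\<Sum>k<dim_vec u * dim_vec v.
      (A $$ (r div dim_row B, k div dim_vec v) * u $ (k div dim_vec v)) *
      (B $$ (r mod dim_row B, k mod dim_vec v) * v $ (k mod dim_vec v)))"
    using r assms by (auto simp: scalar_prod_def lessThan_atLeast0 intro!: sum.cong)
  also have "\<dots> = (\<Sum>i<dim_vec u. A $$ (r div dim_row B, i) * u $ i) *
      (\<Sum>j<dim_vec v. B $$ (r mod dim_row B, j) * v $ j)"
    by (rule sum_div_mod_prod)
  also have "\<dots> = ?r $ r"
    using r b assms by (simp add: scalar_prod_def lessThan_atLeast0)
  finally show "?l $ r = ?r $ r" .
qed simp

lemma kron_mult:
  assumes "dim_col A = dim_row C" "dim_col B = dim_row D"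
  shows "(A \<otimes>\<^sub>m B) * (C \<otimes>\<^sub>m D) = (A * C) \<otimes>\<^sub>m (B * D)" (is "?l = ?r")
proof (rule eq_matI)
  fix r c assume "r < dim_row ?r" "c < dim_col ?r"
  then have r: "r < dim_row A * dim_row B" and c: "c < dim_col C * dim_col D" by simp_all
  note b = div_mod_bounds[OF r] div_mod_bounds[OF c]
  have "?l $$ (r, c) = (\<Sum>k<dim_row C * dim_row D.
      (A $$ (r div dim_row B, k div dim_row D) * C $$ (k div dim_row D, c div dim_col D)) *
      (B $$ (r mod dim_row B, k mod dim_row D) * D $$ (k mod dim_row D, c mod dim_col D)))"
    using r c assms by (auto simp: scalar_prod_def lessThan_atLeast0 intro!: sum.cong)
  also have "\<dots> = (\<Sum>i<dim_row C. A $$ (r div dim_row B, i) * C $$ (i, c div dim_col D)) *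
      (\<Sum>j<dim_row D. B $$ (r mod dim_row B, j) * D $$ (j, c mod dim_col D))"
    by (rule sum_div_mod_prod)
  also have "\<dots> = ?r $$ (r, c)"
    using r c b assms by (simp add: scalar_prod_def lessThan_atLeast0)
  finally show "?l $$ (r, c) = ?r $$ (r, c)" .
qed simp_all

text \<open>With the next two identities this reads off the digits of an index in mixed radix, which
  reconciles the two bracketings of a triple Kronecker product.\<close>

lemma mod_mult_div: "(r::nat) mod (b * c) div c = r div c mod b"
proof (cases "c = 0")
  case False
  then show ?thesis by (simp add: mult.commute[of b] mod_mult2_eq)
qed simp

lemma mod_mult_mod: "(r::nat) mod (b * c) mod c = r mod c"
  by (simp add: mod_mod_cancel)

lemma div_mult_eq_div_div: "(r::nat) div (b * c) = r div c div b"
  by (simp add: mult.commute[of b] div_mult2_eq)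

text \<open>Either bracketing addresses an entry by the same three digits of the row index and of
  the column index, so the entries agree as products of three factors.\<close>

lemma kron_assoc: "(A \<otimes>\<^sub>m B) \<otimes>\<^sub>m C = A \<otimes>\<^sub>m B \<otimes>\<^sub>m C" (is "?l = ?r")
proof (rule eq_matI)
  fix r c assume "r < dim_row ?r" "c < dim_col ?r"
  then have r: "r < (dim_row A * dim_row B) * dim_row C"
    and c: "c < (dim_col A * dim_col B) * dim_col C" by (simp_all add: mult.assoc)
  from r c have r': "r < dim_row A * (dim_row B * dim_row C)"
    and c': "c < dim_col A * (dim_col B * dim_col C)" by (simp_all add: mult.assoc)
  show "?l $$ (r, c) = ?r $$ (r, c)"
    using r c r' c' div_mod_bounds[OF r] div_mod_bounds[OF c]
      div_mod_bounds[OF r'] div_mod_bounds[OF c']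
    by (simp add: mod_mult_div mod_mult_mod div_mult_eq_div_div)
qed (simp_all add: mult.assoc)

text \<open>Two indices are equal exactly when their quotients and their remainders are, so the
  product of two Kronecker deltas is again a delta.\<close>

lemma kron_one: "1\<^sub>m a \<otimes>\<^sub>m 1\<^sub>m b = 1\<^sub>m (a * b)"
proof (rule eq_matI)
  fix r c assume "r < dim_row (1\<^sub>m (a * b))" "c < dim_col (1\<^sub>m (a * b))"
  then have r: "r < a * b" and c: "c < a * b" by simp_all
  have "r = c \<longleftrightarrow> r div b = c div b \<and> r mod b = c mod b"
    by (metis div_mult_mod_eq)
  then show "(1\<^sub>m a \<otimes>\<^sub>m 1\<^sub>m b) $$ (r, c) = 1\<^sub>m (a * b) $$ (r, c)"
    using r c div_mod_bounds[OF r] div_mod_bounds[OF c] by auto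
qed simp_all

lemma add_kron_vec:
  assumes "dim_vec u = dim_vec v"
  shows "(u + v) \<otimes>\<^sub>v w = u \<otimes>\<^sub>v w + v \<otimes>\<^sub>v w"
  using assms by (intro eq_vecI) (auto simp: div_mod_bounds algebra_simps)

lemma smult_kron_vec: "(a \<cdot>\<^sub>v u) \<otimes>\<^sub>v w = a \<cdot>\<^sub>v (u \<otimes>\<^sub>v w)"
  by (intro eq_vecI) (auto simp: div_mod_bounds)

lemma zero_kron_vec [simp]: "0\<^sub>v a \<otimes>\<^sub>v w = 0\<^sub>v (a * dim_vec w)"
  by (intro eq_vecI) (auto simp: div_mod_bounds)

lemma unit_kron_vec_0:
  assumes "0 < a" "0 < b"
  shows "unit_vec a 0 \<otimes>\<^sub>v unit_vec b 0 = unit_vec (a * b) 0"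
proof (rule eq_vecI)
  fix k assume "k < dim_vec (unit_vec (a * b) 0 :: complex vec)"
  then have k: "k < a * b" by simp
  have "k = 0 \<longleftrightarrow> k div b = 0 \<and> k mod b = 0"
    by (metis div_mult_mod_eq div_0 mod_0 mult_0 add_0)
  then show "(unit_vec a 0 \<otimes>\<^sub>v unit_vec b 0) $ k = unit_vec (a * b) 0 $ k"
    using k div_mod_bounds[OF k] by auto
qed simp

section \<open>Computational basis states as unit vectors\<close>

lemma ket_0: "ket m 0 = unit_vec (2 ^ m) 0"
proof -
  \<comment> \<open>The list \<open>xs\<close> is arbitrary and \<open>n\<close> is detached from
    its length, because the induction shortens the list while \<open>bit_of n\<close> keeps its
    \<open>n\<close>. Every bit of 0 is 0, so each factor is \<open>unit_vec 2 0\<close>.\<close>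
  have "foldr (\<otimes>\<^sub>v) (map (\<lambda>l. unit_vec 2 (bit_of n 0 l)) xs) (unit_vec 1 0)
      = unit_vec (2 ^ length xs) 0" for n xs
    by (induction xs) (simp_all add: bit_of_def unit_kron_vec_0)
  from this[of m "[0..<m]"] show ?thesis by (simp add: ket_def kron_vec_list_def)
qed

lemma ket_1_1: "ket 1 1 = unit_vec 2 1"
  by (rule eq_vecI) (auto simp: ket_def kron_vec_list_def bit_of_def)

lemma ket_carrier [simp]: "ket m 0 \<in> carrier_vec (2 ^ m)"
  by (simp add: ket_0)

lemma kron_vec_zero [simp]: "w \<otimes>\<^sub>v 0\<^sub>v a = 0\<^sub>v (dim_vec w * a)"
  by (intro eq_vecI) (auto simp: div_mod_bounds)

section \<open>Gates and circuits\<close>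

lemma pauli_carrier [simp]:
  "pauli_X \<in> carrier_mat 2 2" "pauli_Z \<in> carrier_mat 2 2"
  "proj0 \<in> carrier_mat 2 2" "proj1 \<in> carrier_mat 2 2"
  by (auto simp: pauli_X_def pauli_Z_def proj0_def proj1_def mat_of_rows_list_def)

lemma proj_unit_vec [simp]:
  "proj0 *\<^sub>v unit_vec 2 0 = unit_vec 2 0" "proj0 *\<^sub>v unit_vec 2 1 = 0\<^sub>v 2"
  "proj1 *\<^sub>v unit_vec 2 0 = 0\<^sub>v 2" "proj1 *\<^sub>v unit_vec 2 1 = unit_vec 2 1"
  by (auto simp: proj0_def proj1_def mat_of_rows_list_def scalar_prod_def less_Suc_eq
      numeral_2_eq_2 intro!: eq_vecI)

lemma dim_pauli [simp]:
  "dim_row proj0 = 2" "dim_col proj0 = 2" "dim_row proj1 = 2" "dim_col proj1 = 2"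
  by (simp_all add: proj0_def proj1_def mat_of_rows_list_def)

text \<open>The dimensions of the three tensor factors in \<open>on_qubit m q G\<close> multiply to
  that of the whole register.\<close>

lemma pow2_split:
  assumes "q < m"
  shows "2 ^ q * (2 * 2 ^ (m - 1 - q)) = (2 ^ m :: nat)"
proof -
  have "m = q + Suc (m - 1 - q)" using assms by simp
  then show ?thesis by (metis power_add power_Suc)
qed

section \<open>Gates on a register cut into \<open>m\<close> and \<open>p\<close> qubits\<close>

lemma on_qubit_carrier:
  assumes "q < m" "G \<in> carrier_mat 2 2"
  shows "on_qubit m q G \<in> carrier_mat (2 ^ m) (2 ^ m)"
  using assms pow2_split[OF assms(1)] by (intro carrier_matI) (simp_all add: on_qubit_def)

lemma ctrl_gate_carrier:
  assumes "c < m" "t < m" "G \<in> carrier_mat 2 2"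
  shows "ctrl_gate m c t G \<in> carrier_mat (2 ^ m) (2 ^ m)"
  using assms unfolding ctrl_gate_def
  by (intro add_carrier_mat mult_carrier_mat[of _ _ "2 ^ m"] on_qubit_carrier) auto

text \<open>The identity to the right of the gate absorbs the \<open>p\<close> further qubits. With
  \<open>on_qubit_upper\<close>, where the left identity is split instead, this lets controls and
  targets be treated on separate sides of the cut.\<close>

lemma on_qubit_lower:
  assumes "q < m"
  shows "on_qubit (m + p) q G = on_qubit m q G \<otimes>\<^sub>m 1\<^sub>m (2 ^ p)"
proof -
  have "m + p - 1 - q = (m - 1 - q) + p" using assms by simp
  then show ?thesis by (simp only: on_qubit_def kron_assoc kron_one power_add)
qed

lemma on_qubit_upper: "on_qubit (m + p) (m + t) G = 1\<^sub>m (2 ^ m) \<otimes>\<^sub>m on_qubit p t G"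
proof -
  have "m + p - 1 - (m + t) = p - 1 - t" by simp
  then show ?thesis by (simp only: on_qubit_def power_add kron_one[symmetric] kron_assoc)
qed

lemma on_qubit_ket_0:
  assumes "q < m" "G \<in> carrier_mat 2 2"
  shows "on_qubit m q G *\<^sub>v ket m 0 =
    unit_vec (2 ^ q) 0 \<otimes>\<^sub>v (G *\<^sub>v unit_vec 2 0) \<otimes>\<^sub>v unit_vec (2 ^ (m - 1 - q)) 0"
proof -
  have "ket m 0 = unit_vec (2 ^ q) 0 \<otimes>\<^sub>v unit_vec 2 0 \<otimes>\<^sub>v unit_vec (2 ^ (m - 1 - q)) 0"
    using pow2_split[OF assms(1)] by (simp add: unit_kron_vec_0 ket_0)
  then show ?thesis using assms(2) by (simp add: on_qubit_def kron_mult_vec)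
qed

text \<open>The zero state is a product state whose factor at \<open>q\<close> is
  \<open>unit_vec 2 0\<close>; \<open>proj0\<close> keeps this factor, and \<open>proj1\<close>
  turns it and hence the whole product into zero.\<close>

lemma on_qubit_proj_ket_0:
  assumes "q < m"
  shows "on_qubit m q proj0 *\<^sub>v ket m 0 = ket m 0"
    and "on_qubit m q proj1 *\<^sub>v ket m 0 = 0\<^sub>v (2 ^ m)"
  using assms pow2_split[OF assms]
  by (simp_all add: on_qubit_ket_0 unit_kron_vec_0) (simp add: ket_0)

text \<open>The gate \<open>G\<close> occurs only in the summand behind \<open>proj1\<close> on the
  control, and the control is one of the \<open>m\<close> qubits in the zero state. Hence that
  summand vanishes for every \<open>G\<close> and \<phi>.\<close>

lemma ctrl_gate_fixes:
  assumes "c < m" "t < p" "G \<in> carrier_mat 2 2" "\<phi> \<in> carrier_vec (2 ^ p)"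
  shows "ctrl_gate (m + p) c (m + t) G *\<^sub>v (ket m 0 \<otimes>\<^sub>v \<phi>) = ket m 0 \<otimes>\<^sub>v \<phi>"
proof -
  let ?d = "2 ^ (m + p) :: nat"
  let ?v = "ket m 0 \<otimes>\<^sub>v \<phi>"
  have v: "?v \<in> carrier_vec ?d"
    using kron_vec_carrier[OF ket_carrier assms(4), of m] by (simp add: power_add)
  have P: "on_qubit (m + p) c proj0 \<in> carrier_mat ?d ?d"
    "on_qubit (m + p) c proj1 \<in> carrier_mat ?d ?d"
    "on_qubit (m + p) (m + t) G \<in> carrier_mat ?d ?d"
    using assms by (auto intro!: on_qubit_carrier)
  \<comment> \<open>The vector \<chi> is arbitrary because the projectors meet two states of the
    last \<open>p\<close> qubits: \<phi> itself, and \<phi> after \<open>G\<close> has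
    acted.\<close>
  have lower: "on_qubit (m + p) c Q *\<^sub>v (ket m 0 \<otimes>\<^sub>v \<chi>) = (on_qubit m c Q *\<^sub>v ket m 0) \<otimes>\<^sub>v \<chi>"
    if "\<chi> \<in> carrier_vec (2 ^ p)" "Q \<in> carrier_mat 2 2" for \<chi> Q
    using that on_qubit_carrier[OF assms(1), of Q] by (simp add: on_qubit_lower[OF assms(1)] kron_mult_vec ket_0)
  have upper: "on_qubit (m + p) (m + t) G *\<^sub>v ?v = ket m 0 \<otimes>\<^sub>v (on_qubit p t G *\<^sub>v \<phi>)"
    using assms on_qubit_carrier[OF assms(2,3)]
    by (simp add: on_qubit_upper kron_mult_vec ket_0)
  have \<chi>: "on_qubit p t G *\<^sub>v \<phi> \<in> carrier_vec (2 ^ p)"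
    using assms(4) on_qubit_carrier[OF assms(2,3)] by simp
  have "ctrl_gate (m + p) c (m + t) G *\<^sub>v ?v =
      on_qubit (m + p) c proj0 *\<^sub>v ?v +
      on_qubit (m + p) c proj1 *\<^sub>v (on_qubit (m + p) (m + t) G *\<^sub>v ?v)"
    unfolding ctrl_gate_def using P v
    by (simp add: add_mult_distrib_mat_vec[of _ ?d ?d] mult_carrier_mat[of _ _ ?d]
        assoc_mult_mat_vec[of _ ?d ?d _ ?d])
  \<comment> \<open>With \<open>dim_mult_mat_vec\<close> removed, the dimension of the transformed
    \<phi> comes from \<chi> instead of being rewritten to a row count.\<close>
  also have "\<dots> = ?v + 0\<^sub>v ?d"
    using assms(1,4) carrier_vecD[OF \<chi>]
    by (simp add: upper lower[OF \<chi>] lower on_qubit_proj_ket_0 power_add del: dim_mult_mat_vec)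
  finally show ?thesis using v by simp
qed

section \<open>Circuits, and \<open>SELECT\<close> on zero ancillas\<close>

lemma circuit_fixes:
  assumes "\<And>G. G \<in> set Gs \<Longrightarrow> G \<in> carrier_mat (2 ^ m) (2 ^ m)"
    and "\<And>G. G \<in> set Gs \<Longrightarrow> G *\<^sub>v v = v"
    and "v \<in> carrier_vec (2 ^ m)"
  shows "circuit m Gs *\<^sub>v v = v"
proof -
  \<comment> \<open>The accumulator must be generalised from the identity to any \<open>A\<close>
    fixing \<open>v\<close>, since \<open>fold\<close> changes it at each gate.\<close>
  have "fold (\<lambda>G A. G * A) Gs A *\<^sub>v v = v"
    if "A \<in> carrier_mat (2 ^ m) (2 ^ m)" "A *\<^sub>v v = v" for A
    using assms(1,2) that
  proof (induction Gs arbitrary: A)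
    case (Cons G Gs)
    have "(G * A) *\<^sub>v v = v"
      using Cons.prems assms(3) by (simp add: assoc_mult_mat_vec[of _ "2 ^ m" "2 ^ m" _ "2 ^ m"])
    then show ?case using Cons by (simp add: mult_carrier_mat[of _ _ "2 ^ m"])
  qed simp
  then show ?thesis using assms(3) by (simp add: circuit_def)
qed

lemma circuit_carrier:
  assumes "\<And>G. G \<in> set Gs \<Longrightarrow> G \<in> carrier_mat (2 ^ m) (2 ^ m)"
  shows "circuit m Gs \<in> carrier_mat (2 ^ m) (2 ^ m)"
proof -
  have "fold (\<lambda>G A. G * A) Gs A \<in> carrier_mat (2 ^ m) (2 ^ m)"
    if "A \<in> carrier_mat (2 ^ m) (2 ^ m)" for A
    using assms that
    by (induction Gs arbitrary: A) (auto simp: mult_carrier_mat[of _ _ "2 ^ m"])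
  then show ?thesis by (simp add: circuit_def)
qed

lemma SELECT_carrier: "SELECT n \<in> carrier_mat (2 ^ (3 * n)) (2 ^ (3 * n))"
  unfolding SELECT_def by (intro circuit_carrier) (auto intro!: ctrl_gate_carrier)

text \<open>Both the CNOT and the CZ layer have their controls in the first \<open>2 * n\<close>
  qubits and their targets in the last \<open>n\<close>, so each gate is an instance of
  \<open>ctrl_gate_fixes\<close>.\<close>

lemma SELECT_fixes:
  assumes "\<phi> \<in> carrier_vec (2 ^ n)"
  shows "SELECT n *\<^sub>v (ket (2 * n) 0 \<otimes>\<^sub>v \<phi>) = ket (2 * n) 0 \<otimes>\<^sub>v \<phi>"
proof -
  have n3: "2 * n + n = 3 * n" by simp
  show ?thesis
    unfolding SELECT_def
  proof (rule circuit_fixes)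
    show "ket (2 * n) 0 \<otimes>\<^sub>v \<phi> \<in> carrier_vec (2 ^ (3 * n))"
      unfolding n3[symmetric] power_add by (intro kron_vec_carrier ket_carrier assms)
  qed (use assms in \<open>auto intro!: ctrl_gate_carrier
      ctrl_gate_fixes[of _ "2 * n" _ n, unfolded n3]\<close>)
qed

section \<open>Controlled operators\<close>

lemma ctrl_carrier:
  assumes "V \<in> carrier_mat d d"
  shows "\<Lambda> V \<in> carrier_mat (2 * d) (2 * d)"
  using carrier_matD[OF assms] by (intro carrier_matI) (simp_all add: ctrl_def)

text \<open>On a basis state of the control one projector acts as the identity and the other gives
  zero, so a single summand of \<open>\<Lambda> V\<close> survives.\<close>

lemma ctrl_mult_unit:
  assumes "V \<in> carrier_mat d d" "w \<in> carrier_vec d"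
  shows "\<Lambda> V *\<^sub>v (unit_vec 2 0 \<otimes>\<^sub>v w) = unit_vec 2 0 \<otimes>\<^sub>v w"
    and "\<Lambda> V *\<^sub>v (unit_vec 2 1 \<otimes>\<^sub>v w) = unit_vec 2 1 \<otimes>\<^sub>v (V *\<^sub>v w)"
proof -
  have *: "\<Lambda> V *\<^sub>v (u \<otimes>\<^sub>v w) = (proj0 *\<^sub>v u) \<otimes>\<^sub>v w + (proj1 *\<^sub>v u) \<otimes>\<^sub>v (V *\<^sub>v w)"
    if "u \<in> carrier_vec 2" for u
  proof -
    have "\<Lambda> V *\<^sub>v (u \<otimes>\<^sub>v w) =
        (proj0 \<otimes>\<^sub>m 1\<^sub>m d) *\<^sub>v (u \<otimes>\<^sub>v w) + (proj1 \<otimes>\<^sub>m V) *\<^sub>v (u \<otimes>\<^sub>v w)"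
      unfolding ctrl_def carrier_matD(1)[OF assms(1)] using assms that
      by (intro add_mult_distrib_mat_vec[of _ "2 * d" "2 * d"] kron_carrier kron_vec_carrier) simp_all
    then show ?thesis using assms that by (simp add: kron_mult_vec)
  qed
  show "\<Lambda> V *\<^sub>v (unit_vec 2 0 \<otimes>\<^sub>v w) = unit_vec 2 0 \<otimes>\<^sub>v w"
    using assms kron_vec_carrier[OF unit_vec_carrier assms(2), of 2 0] by (simp add: *)
  \<comment> \<open>\<open>One_nat_def\<close> would turn the index 1 into \<open>Suc 0\<close>, and
    the rules for \<open>unit_vec 2 1\<close> would no longer match.\<close>
  show "\<Lambda> V *\<^sub>v (unit_vec 2 1 \<otimes>\<^sub>v w) = unit_vec 2 1 \<otimes>\<^sub>v (V *\<^sub>v w)"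
    using assms kron_vec_carrier[OF unit_vec_carrier mult_mat_vec_carrier[OF assms], of 2 1]
    by (simp add: * del: One_nat_def)
qed

section \<open>Adjoints and linearity\<close>

lemma dim_mat_adjoint [simp]:
  "dim_row (mat_adjoint A) = dim_col A" "dim_col (mat_adjoint A) = dim_row A"
  by (simp_all add: mat_adjoint_def)

lemma mat_adjoint_carrier [simp]:
  "A \<in> carrier_mat r c \<Longrightarrow> mat_adjoint A \<in> carrier_mat c r"
  by (metis carrier_matD carrier_matI dim_mat_adjoint)

lemma mat_adjoint_index:
  fixes A :: "complex mat"
  shows "i < dim_col A \<Longrightarrow> j < dim_row A \<Longrightarrow> mat_adjoint A $$ (i, j) = cnj (A $$ (j, i))"
  by (simp add: mat_adjoint_def mat_of_rows_def)

lemma mat_adjoint_mult: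
  fixes A B :: "complex mat"
  assumes "A \<in> carrier_mat r m" "B \<in> carrier_mat m c"
  shows "mat_adjoint (A * B) = mat_adjoint B * mat_adjoint A"
proof (rule eq_matI)
  fix i j assume "i < dim_row (mat_adjoint B * mat_adjoint A)"
    "j < dim_col (mat_adjoint B * mat_adjoint A)"
  then have ij: "i < c" "j < r" using assms by simp_all
  have "mat_adjoint (A * B) $$ (i, j) = cnj (\<Sum>k<m. A $$ (j, k) * B $$ (k, i))"
    using ij assms by (simp add: mat_adjoint_index scalar_prod_def lessThan_atLeast0)
  also have "\<dots> = (\<Sum>k<m. mat_adjoint B $$ (i, k) * mat_adjoint A $$ (k, j))"
    using ij assms by (simp add: mat_adjoint_index mult.commute)
  also have "\<dots> = (mat_adjoint B * mat_adjoint A) $$ (i, j)"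
    using ij assms by (simp add: scalar_prod_def lessThan_atLeast0)
  finally show "mat_adjoint (A * B) $$ (i, j) = (mat_adjoint B * mat_adjoint A) $$ (i, j)" .
qed simp_all

lemma mult_mat_vec_lincomb:
  fixes M :: "complex mat"
  assumes "M \<in> carrier_mat r c" "x \<in> carrier_vec c" "y \<in> carrier_vec c"
  shows "M *\<^sub>v (a \<cdot>\<^sub>v x + b \<cdot>\<^sub>v y) = a \<cdot>\<^sub>v (M *\<^sub>v x) + b \<cdot>\<^sub>v (M *\<^sub>v y)"
  using assms by (simp add: mult_add_distrib_mat_vec[of _ r c] mult_mat_vec[of _ r c])

section \<open>Comparison of the two circuits on the control basis states\<close>

theorem corollary2:
  fixes n :: nat
    and H P\<^sub>R P\<^sub>L V\<^sub>R V\<^sub>L :: "complex mat"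
    and \<alpha> :: "nat \<Rightarrow> nat \<Rightarrow> complex"
    and A\<^sub>R A\<^sub>L :: "nat \<Rightarrow> complex mat"
  assumes "n \<ge> 1"
    and "H \<in> carrier_mat (2 ^ n) (2 ^ n)"
    and "H \<noteq> 0\<^sub>m (2 ^ n) (2 ^ n)"
    and "H = pauli_expansion n \<alpha>"
    and "right_prep_oracle n \<alpha> P\<^sub>R"
    and "left_prep_oracle n \<alpha> P\<^sub>L"
    and "unitary_mat (2 ^ (2 * n)) V\<^sub>R"
    and "unitary_mat (2 ^ (2 * n)) V\<^sub>L"
    and "unitary_mat (2 ^ (2 * n)) (A\<^sub>R n)"
    and "unitary_mat (2 ^ (2 * n)) (A\<^sub>L n)"
    and "P\<^sub>R = V\<^sub>R * A\<^sub>R n"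
    and "P\<^sub>L = V\<^sub>L * A\<^sub>L n"
    and "V\<^sub>R *\<^sub>v ket (2 * n) 0 = ket (2 * n) 0"
    and "V\<^sub>L *\<^sub>v ket (2 * n) 0 = ket (2 * n) 0"
    and "O1_single_qubit_gates A\<^sub>R"
    and "O1_single_qubit_gates A\<^sub>L"
  shows "\<forall>a b \<phi>. (cmod a)\<^sup>2 + (cmod b)\<^sup>2 = 1 \<longrightarrow> qstate n \<phi> \<longrightarrow>
    (let \<psi> = (a \<cdot>\<^sub>v ket 1 0 + b \<cdot>\<^sub>v ket 1 1) \<otimes>\<^sub>v ket (2 * n) 0 \<otimes>\<^sub>v \<phi> in
      \<Lambda> (U_FOX n P\<^sub>R P\<^sub>L) *\<^sub>v \<psi> =
      (\<Lambda> (mat_adjoint (A\<^sub>L n) \<otimes>\<^sub>m 1\<^sub>m (2 ^ n))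
        * (1\<^sub>m 2 \<otimes>\<^sub>m
            ((mat_adjoint V\<^sub>L \<otimes>\<^sub>m 1\<^sub>m (2 ^ n)) * SELECT n * (V\<^sub>R \<otimes>\<^sub>m 1\<^sub>m (2 ^ n))))
        * \<Lambda> (A\<^sub>R n \<otimes>\<^sub>m 1\<^sub>m (2 ^ n))) *\<^sub>v \<psi>)"
proof -
  let ?d = "2 ^ (2 * n) :: nat" and ?e = "2 ^ n :: nat" and ?D = "2 ^ (3 * n) :: nat"
  let ?I = "1\<^sub>m ?e :: complex mat"
  \<comment> \<open>\<open>SELECT\<close> has its dimension as one power of two, the Kronecker
    products as a product of two; this equation mediates between them.\<close>
  have D: "?D = ?d * ?e" by (simp flip: power_add)
  define W where "W = (mat_adjoint V\<^sub>L \<otimes>\<^sub>m ?I) * SELECT n * (V\<^sub>R \<otimes>\<^sub>m ?I)"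
  let ?L = "mat_adjoint (A\<^sub>L n) \<otimes>\<^sub>m ?I" and ?R = "A\<^sub>R n \<otimes>\<^sub>m ?I"
  let ?M = "\<Lambda> ?L * (1\<^sub>m 2 \<otimes>\<^sub>m W) * \<Lambda> ?R"
  have V: "V\<^sub>R \<in> carrier_mat ?d ?d" "V\<^sub>L \<in> carrier_mat ?d ?d"
    "A\<^sub>R n \<in> carrier_mat ?d ?d" "A\<^sub>L n \<in> carrier_mat ?d ?d"
    using assms by (auto simp: unitary_mat_def)
  note V' = mat_adjoint_carrier[OF V(2)] mat_adjoint_carrier[OF V(4)]
  have K: "A \<otimes>\<^sub>m ?I \<in> carrier_mat ?D ?D" if "A \<in> carrier_mat ?d ?d" for A
    unfolding D using that by auto
  note KV = K[OF V(1)] K[OF V(3)] K[OF V'(1)] K[OF V'(2)] SELECT_carrier[of n]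
  have W: "W \<in> carrier_mat ?D ?D"
    unfolding W_def using KV by (auto intro!: mult_carrier_mat[of _ _ ?D])
  have W2: "1\<^sub>m 2 \<otimes>\<^sub>m W \<in> carrier_mat (2 * ?D) (2 * ?D)" using W by auto
  note \<Lambda> = ctrl_carrier[OF KV(2)] ctrl_carrier[OF KV(4)]
  have M: "?M \<in> carrier_mat (2 * ?D) (2 * ?D)"
    using \<Lambda> W2 by (auto intro!: mult_carrier_mat[of _ _ "2 * ?D"])
  \<comment> \<open>An identity of operators, valid on every state: the adjoint reverses
    \<open>V\<^sub>L * A\<^sub>L n\<close>, so the adjoint of \<open>A\<^sub>L n\<close> ends up
    outermost and \<open>W\<close> in the middle.\<close>
  have U: "U_FOX n P\<^sub>R P\<^sub>L = ?L * W * ?R"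
  proof -
    have "mat_adjoint P\<^sub>L \<otimes>\<^sub>m ?I = ?L * (mat_adjoint V\<^sub>L \<otimes>\<^sub>m ?I)"
      using V V' assms(12) by (simp add: kron_mult mat_adjoint_mult[of _ ?d ?d _ ?d])
    moreover have "P\<^sub>R \<otimes>\<^sub>m ?I = (V\<^sub>R \<otimes>\<^sub>m ?I) * ?R"
      using V assms(11) by (simp add: kron_mult)
    ultimately show ?thesis
      unfolding U_FOX_def W_def using KV
      by (simp add: assoc_mult_mat[of _ ?D ?D _ ?D _ ?D] mult_carrier_mat[of _ _ ?D])
  qed
  then have UC: "U_FOX n P\<^sub>R P\<^sub>L \<in> carrier_mat ?D ?D"
    using KV W by (auto intro!: mult_carrier_mat[of _ _ ?D])
  \<comment> \<open>Apply the adjoint of \<open>V\<^sub>L\<close> to the equation saying that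
    \<open>V\<^sub>L\<close> fixes the zero state, and cancel by unitarity.\<close>
  have VL: "mat_adjoint V\<^sub>L *\<^sub>v ket (2 * n) 0 = ket (2 * n) 0"
  proof -
    have "mat_adjoint V\<^sub>L *\<^sub>v (V\<^sub>L *\<^sub>v ket (2 * n) 0) = (mat_adjoint V\<^sub>L * V\<^sub>L) *\<^sub>v ket (2 * n) 0"
      using V V' by (simp add: assoc_mult_mat_vec[of _ ?d ?d _ ?d])
    also have "\<dots> = ket (2 * n) 0" using assms(8) by (simp add: unitary_mat_def)
    finally show ?thesis using assms(14) by simp
  qed
  have MW: "?M *\<^sub>v v = \<Lambda> ?L *\<^sub>v ((1\<^sub>m 2 \<otimes>\<^sub>m W) *\<^sub>v (\<Lambda> ?R *\<^sub>v v))"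
    if "v \<in> carrier_vec (2 * ?D)" for v
    using \<Lambda> W2 that
    by (simp add: assoc_mult_mat_vec[of _ "2 * ?D" "2 * ?D" _ "2 * ?D"]
        mult_carrier_mat[of _ _ "2 * ?D"] mult_mat_vec_carrier[of _ "2 * ?D" "2 * ?D"])
  have I2W: "(1\<^sub>m 2 \<otimes>\<^sub>m W) *\<^sub>v (u \<otimes>\<^sub>v v) = u \<otimes>\<^sub>v (W *\<^sub>v v)"
    if "u \<in> carrier_vec 2" "v \<in> carrier_vec ?D" for u v
    using that W by (simp add: kron_mult_vec)
  have "\<Lambda> (U_FOX n P\<^sub>R P\<^sub>L) *\<^sub>v \<psi> = ?M *\<^sub>v \<psi>"
    if "\<phi> \<in> carrier_vec ?e"
      and \<psi>: "\<psi> = (a \<cdot>\<^sub>v ket 1 0 + b \<cdot>\<^sub>v ket 1 1) \<otimes>\<^sub>v ket (2 * n) 0 \<otimes>\<^sub>v \<phi>" for a b \<phi> \<psi>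
  proof -
    define w where "w = ket (2 * n) 0 \<otimes>\<^sub>v \<phi>"
    have w: "w \<in> carrier_vec ?D" unfolding w_def D using that by auto
    let ?x = "unit_vec 2 0 \<otimes>\<^sub>v w" and ?y = "unit_vec 2 1 \<otimes>\<^sub>v w"
    have xy: "?x \<in> carrier_vec (2 * ?D)" "?y \<in> carrier_vec (2 * ?D)" using w by auto
    \<comment> \<open>The state is expanded in the control basis only; both circuits are linear, so
      agreement on \<open>?x\<close> and on \<open>?y\<close> suffices.\<close>
    have \<psi>_eq: "\<psi> = a \<cdot>\<^sub>v ?x + b \<cdot>\<^sub>v ?y"
      unfolding \<psi> w_def ket_1_1 by (simp add: ket_0 add_kron_vec smult_kron_vec)
    have fix_V: "(A \<otimes>\<^sub>m ?I) *\<^sub>v w = w"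
      if "A \<in> carrier_mat ?d ?d" "A *\<^sub>v ket (2 * n) 0 = ket (2 * n) 0" for A
      unfolding w_def using that \<open>\<phi> \<in> carrier_vec ?e\<close> by (simp add: kron_mult_vec ket_0)
    \<comment> \<open>The uncontrolled middle part acts even when the control is 0, so there it has
      to leave \<open>w\<close> unchanged.\<close>
    have "W *\<^sub>v w = (mat_adjoint V\<^sub>L \<otimes>\<^sub>m ?I) *\<^sub>v (SELECT n *\<^sub>v ((V\<^sub>R \<otimes>\<^sub>m ?I) *\<^sub>v w))"
      unfolding W_def using KV w
      by (simp add: assoc_mult_mat_vec[of _ ?D ?D _ ?D] mult_carrier_mat[of _ _ ?D]
          mult_mat_vec_carrier[of _ ?D ?D])
    also have "\<dots> = w"
      using SELECT_fixes[OF that(1)] fix_V[OF V(1) assms(13)] fix_V[OF V'(1) VL]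
      by (simp add: w_def)
    finally have Ww: "W *\<^sub>v w = w" .
    \<comment> \<open>All three controlled operators are idle here, and \<open>W\<close> fixes
      \<open>w\<close>.\<close>
    have x: "\<Lambda> (U_FOX n P\<^sub>R P\<^sub>L) *\<^sub>v ?x = ?M *\<^sub>v ?x"
      using w xy Ww
      by (simp add: MW I2W ctrl_mult_unit(1)[OF KV(2)] ctrl_mult_unit(1)[OF KV(4)]
          ctrl_mult_unit(1)[OF UC])
    have Rw: "?R *\<^sub>v w \<in> carrier_vec ?D" "W *\<^sub>v (?R *\<^sub>v w) \<in> carrier_vec ?D"
      using KV W w by (auto intro!: mult_mat_vec_carrier[of _ ?D ?D])
    have "U_FOX n P\<^sub>R P\<^sub>L *\<^sub>v w = ?L *\<^sub>v (W *\<^sub>v (?R *\<^sub>v w))"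
      unfolding U using KV W w Rw
      by (simp add: assoc_mult_mat_vec[of _ ?D ?D _ ?D] mult_carrier_mat[of _ _ ?D])
    \<comment> \<open>Here every controlled operator fires, and the circuit composes to the
      factorisation \<open>U\<close>.\<close>
    then have y: "\<Lambda> (U_FOX n P\<^sub>R P\<^sub>L) *\<^sub>v ?y = ?M *\<^sub>v ?y"
      using w xy Rw
      by (simp add: MW I2W ctrl_mult_unit(2)[OF KV(2)] ctrl_mult_unit(2)[OF KV(4)]
          ctrl_mult_unit(2)[OF UC] del: One_nat_def)
    show ?thesis
      unfolding \<psi>_eq mult_mat_vec_lincomb[OF ctrl_carrier[OF UC] xy]
      mult_mat_vec_lincomb[OF M xy] x y ..
  qed
  then show ?thesis
    unfolding Let_def W_def qstate_def by blast
qed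

end
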